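(* Let $a,b,c,d\in\mathbb{C}$ with $c\neq 0$ and $ad-bc=1$, and let $f(z)=\frac{az+b}{cz+d}$ be the corresponding Möbius map on $\hat{\mathbb{C}}=\mathbb{C}\cup\{\infty\}$. If $f$ is elliptic, that is, $a+d$ is real and $-2<a+d<2$, then every sequence $\{b_n\}_{n\in\mathbb{N}_0}$ satisfying $b_{n+1}=f(b_n)$ for $n\in\mathbb{N}_0$ has no Hyers-Ulam stability on $\mathbb{C}$.
   Context: $\mathbb{N}=\{1,2,3,\dots\}$, $\mathbb{N}_0=\mathbb{N}\cup\{0\}$. The map is defined at the special points by $f(-d/c)=\infty$ and $f(\infty)=a/c$. Hyers-Ulam stability on $\mathbb{C}$: the difference equation $b_{n+1}=f(b_n)$ ($n\in\mathbb{N}_0$) has Hyers-Ulam stability if there is a function $G:(0,\infty)\to(0,\infty)$ with $G(\varepsilon)\to 0$ as $\varepsilon\to 0$ such that for every $\varepsilon>0$ and every sequence $\{a_n\}_{n\in\mathbb{N}_0}$ in $\mathbb{C}$ with $f(a_n)\neq\infty$ and $|a_{n+1}-f(a_n)|\le\varepsilon$ for all $n\in\mathbb{N}_0$, there is a sequence $\{b_n\}_{n\in\mathbb{N}_0}$ in $\mathbb{C}$ satisfying $b_{n+1}=f(b_n)$ and $|a_n-b_n|\le G(\varepsilon)$ for all $n\in\mathbb{N}_0$. A sequence $\{b_n\}$ solving the difference equation is said to have no Hyers-Ulam stability if the difference equation it solves does not have Hyers-Ulam stability. *)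

theory Defs
  imports "HOL-Analysis.Analysis"
begin

text \<open>
  The Riemann sphere is the one-point compactification of the complex plane, on the carrier
  that \<^const>\<open>Alexandroff_compactification\<close> uses: \<^term>\<open>Some z\<close> is the finite point \<open>z\<close> and
  \<^term>\<open>None\<close> is the point at infinity.
\<close>

type_synonym riemann_sphere = "complex option"

text \<open>
  For \<open>c \<noteq> 0\<close> the pole \<open>-d/c\<close> is the only zero of \<open>c * z + d\<close>, and infinity is sent to \<open>a/c\<close>.
\<close>

definition moebius_map ::
    "complex \<Rightarrow> complex \<Rightarrow> complex \<Rightarrow> complex \<Rightarrow> riemann_sphere \<Rightarrow> riemann_sphere" where
  "moebius_map a b c d x =
     (case x of
        None \<Rightarrow> if c = 0 then None else Some (a / c)
      | Some z \<Rightarrow> if c * z + d = 0 then None else Some ((a * z + b) / (c * z + d)))"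

definition solves_difference_eq :: "('a \<Rightarrow> 'a) \<Rightarrow> (nat \<Rightarrow> 'a) \<Rightarrow> bool" where
  "solves_difference_eq f u \<longleftrightarrow> (\<forall>n. u (Suc n) = f (u n))"

text \<open>
  Hyers-Ulam stability on the complex plane. The function \<open>G\<close> is only constrained on the positive
  reals. Both sequences lie in the plane, so in particular the exact solution \<open>v\<close> never
  visits infinity.
\<close>

definition hyers_ulam_stable_on_C :: "(riemann_sphere \<Rightarrow> riemann_sphere) \<Rightarrow> bool" where
  "hyers_ulam_stable_on_C f \<longleftrightarrow>
     (\<exists>G :: real \<Rightarrow> real.
        (\<forall>\<epsilon>>0. G \<epsilon> > 0) \<and> (G \<longlongrightarrow> 0) (at_right 0) \<and>
        (\<forall>\<epsilon>>0. \<forall>u :: nat \<Rightarrow> complex.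
           (\<forall>n. f (Some (u n)) \<noteq> None \<and> cmod (u (Suc n) - the (f (Some (u n)))) \<le> \<epsilon>) \<longrightarrow>
           (\<exists>v :: nat \<Rightarrow> complex.
              solves_difference_eq f (\<lambda>n. Some (v n)) \<and>
              (\<forall>n. cmod (u n - v n) \<le> G \<epsilon>))))"

text \<open>
  A solution of the difference equation is said to have no Hyers-Ulam stability when the
  equation it solves does not have Hyers-Ulam stability.
\<close>

definition has_no_hyers_ulam_stability_on_C ::
    "(riemann_sphere \<Rightarrow> riemann_sphere) \<Rightarrow> (nat \<Rightarrow> riemann_sphere) \<Rightarrow> bool" where
  "has_no_hyers_ulam_stability_on_C f u \<longleftrightarrow>
     solves_difference_eq f u \<and> \<not> hyers_ulam_stable_on_C f"

end

theory Submission
  imports Defs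
begin

text \<open>
  An elliptic \<open>f\<close> has two distinct finite fixed points \<open>p\<close> and \<open>q\<close>, and in the coordinate
  \<open>w = (z - p) / (z - q)\<close> it is a rotation. Exact orbits therefore keep \<open>\<bar>w\<bar>\<close> constant, whereas
  errors of size \<open>\<epsilon>\<close> suffice to spiral outwards from \<open>p\<close>, where \<open>w = 0\<close>, to the circle
  \<open>\<bar>w\<bar> = 1/2\<close>. An exact orbit close to the start of the spiral stays close to \<open>p\<close>, so it is not
  close to the end of the spiral, however small \<open>\<epsilon>\<close> is.
\<close>

text \<open>
  The values \<open>c * p + d\<close> and \<open>c * q + d\<close> are the eigenvalues of the coefficient matrix.
\<close>

lemma elliptic_fixed_points:
  fixes a b c d :: complex
  assumes "c \<noteq> 0" and det: "a * d - b * c = 1"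
    and elliptic: "a + d \<in> \<real>" "-2 < Re (a + d)" "Re (a + d) < 2"
  obtains p q where "p \<noteq> q" "a * p + b = p * (c * p + d)" "a * q + b = q * (c * q + d)"
    "cmod (c * p + d) = 1" "cmod (c * q + d) = 1"
proof -
  define t where "t = Re (a + d)"
  have t: "a + d = of_real t"
    using elliptic(1) unfolding t_def by (simp only: of_real_Re)
  have "\<bar>t\<bar> < 2"
    using elliptic by (simp add: t_def)
  then have "t\<^sup>2 < 2\<^sup>2"
    by (metis abs_ge_zero power2_abs power_strict_mono zero_less_numeral)
  define s where "s = sqrt (4 - t\<^sup>2)"
  have s: "s > 0" "s\<^sup>2 = 4 - t\<^sup>2"
    using \<open>t\<^sup>2 < 2\<^sup>2\<close> by (simp_all add: s_def)
  \<comment> \<open>The characteristic polynomial \<open>x\<^sup>2 - t * x + 1\<close> has negative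
    discriminant \<open>t\<^sup>2 - 4\<close>, so its roots are \<open>\<mu>\<close> and
    \<open>cnj \<mu>\<close>. Their product is 1, which puts both on the unit circle.\<close>
  define \<mu> where "\<mu> = Complex (t / 2) (s / 2)"
  have norm: "cmod \<mu> = 1"
    using s by (simp add: \<mu>_def cmod_def power_divide flip: add_divide_distrib)
  have "\<mu> \<noteq> cnj \<mu>"
    using s by (simp add: \<mu>_def complex_eq_iff)
  have char: "\<mu>\<^sup>2 - (a + d) * \<mu> + 1 = 0" "(cnj \<mu>)\<^sup>2 - (a + d) * cnj \<mu> + 1 = 0"
    unfolding t using s(2)
    by (simp_all add: \<mu>_def complex_eq_iff power2_eq_square field_simps)
  \<comment> \<open>Solving \<open>c * p + d = x\<close> for \<open>p\<close> turns an eigenvalue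
    \<open>x\<close> into a fixed point.\<close>
  have fixed: "a * ((x - d) / c) + b = (x - d) / c * x" if "x\<^sup>2 - (a + d) * x + 1 = 0" for x
    using that det \<open>c \<noteq> 0\<close> by (simp add: field_simps power2_eq_square)
  show thesis
    by (rule that[of "(\<mu> - d) / c" "(cnj \<mu> - d) / c"])
      (use \<open>c \<noteq> 0\<close> \<open>\<mu> \<noteq> cnj \<mu>\<close> norm fixed char in \<open>simp_all\<close>)
qed

text \<open>The inverse of the coordinate \<open>w = (z - p) / (z - q)\<close>.\<close>

definition from_fixed_points :: "'a \<Rightarrow> 'a \<Rightarrow> 'a \<Rightarrow> 'a::field" where
  "from_fixed_points p q w = (p - q * w) / (1 - w)"

lemma from_fixed_points_0 [simp]: "from_fixed_points p q 0 = p"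
  by (simp add: from_fixed_points_def)

lemma from_fixed_points_diff:
  assumes "w \<noteq> 1" "w' \<noteq> 1"
  shows "from_fixed_points p q w - from_fixed_points p q w' =
    (p - q) * (w - w') / ((1 - w) * (1 - w'))"
  using assms unfolding from_fixed_points_def by (simp add: divide_simps) algebra

lemma from_fixed_points_diff_fst:
  assumes "w \<noteq> 1"
  shows "from_fixed_points p q w - p = w * (p - q) / (1 - w)"
  using assms unfolding from_fixed_points_def by (simp add: field_simps)

lemma from_fixed_points_diff_snd:
  assumes "w \<noteq> 1"
  shows "from_fixed_points p q w - q = (p - q) / (1 - w)"
  using assms unfolding from_fixed_points_def by (simp add: field_simps)

text \<open>The disc of radius 1/2 stays at distance at least 1/2 from the pole
  \<open>w = 1\<close>, so the denominator in the difference formula has modulus at least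
  1/4.\<close>

lemma from_fixed_points_Lipschitz:
  fixes p q w w' :: complex
  assumes "cmod w \<le> 1/2" "cmod w' \<le> 1/2"
  shows "cmod (from_fixed_points p q w - from_fixed_points p q w') \<le> 4 * cmod (p - q) * cmod (w - w')"
proof -
  have half: "1/2 \<le> cmod (1 - x)" if "cmod x \<le> 1/2" for x
    using norm_triangle_ineq2[of 1 x] that by simp
  have "1/2 * (1/2) \<le> cmod (1 - w) * cmod (1 - w')"
    by (intro mult_mono half assms) auto
  then have "cmod (p - q) * cmod (w - w') / (cmod (1 - w) * cmod (1 - w'))
      \<le> cmod (p - q) * cmod (w - w') / (1/2 * (1/2))"
    by (intro divide_left_mono) (auto intro!: mult_nonneg_nonneg mult_pos_pos)
  moreover have "w \<noteq> 1" "w' \<noteq> 1"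
    using assms by auto
  ultimately show ?thesis
    by (simp add: from_fixed_points_diff norm_mult norm_divide)
qed

text \<open>Conjugation to a rotation: the multiplier is the quotient of the two eigenvalues. The
  coordinate of infinity is \<open>w = 1\<close>, and the open unit disc, which the rotation
  preserves, avoids it.\<close>

lemma moebius_map_from_fixed_points:
  assumes p: "a * p + b = p * (c * p + d)" and q: "a * q + b = q * (c * q + d)"
    and norm: "cmod (c * p + d) = 1" "cmod (c * q + d) = 1" and w: "cmod w < 1"
  shows "moebius_map a b c d (Some (from_fixed_points p q w)) =
    Some (from_fixed_points p q ((c * q + d) / (c * p + d) * w))"
proof -
  define \<mu> \<nu> where "\<mu> = c * p + d" and "\<nu> = c * q + d"
  define z where "z = from_fixed_points p q w"
  have "w \<noteq> 1"
    using w by auto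
  have "\<mu> \<noteq> 0"
    using norm by (auto simp: \<mu>_def)
  have "cmod (\<nu> * w) < cmod \<mu>"
    using norm w by (simp add: \<mu>_def \<nu>_def norm_mult)
  then have nz: "\<mu> - \<nu> * w \<noteq> 0"
    by auto
  have z: "z * (1 - w) = p - q * w"
    using \<open>w \<noteq> 1\<close> by (simp add: z_def from_fixed_points_def)
  \<comment> \<open>Multiplying by \<open>1 - w\<close> makes both parts of the fraction linear in
    \<open>w\<close>; the fixed point equations supply the coefficients.\<close>
  have den: "(c * z + d) * (1 - w) = \<mu> - \<nu> * w"
    using z unfolding \<mu>_def \<nu>_def by algebra
  have num: "(a * z + b) * (1 - w) = p * \<mu> - q * \<nu> * w"
    using z p q unfolding \<mu>_def \<nu>_def by algebra
  have "(a * z + b) / (c * z + d) = (p * \<mu> - q * \<nu> * w) / (\<mu> - \<nu> * w)"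
    unfolding num[symmetric] den[symmetric] using \<open>w \<noteq> 1\<close> by simp
  also have "\<dots> = from_fixed_points p q (\<nu> / \<mu> * w)"
    using \<open>\<mu> \<noteq> 0\<close> nz by (simp add: from_fixed_points_def divide_simps mult_ac)
  finally have "(a * z + b) / (c * z + d) = from_fixed_points p q (\<nu> / \<mu> * w)" .
  moreover have "c * z + d \<noteq> 0"
    using den nz by auto
  ultimately show ?thesis
    by (simp add: moebius_map_def flip: z_def \<mu>_def \<nu>_def)
qed

text \<open>This is the formula for \<open>f z - f p\<close> when the determinant is 1, with
  denominators cleared and \<open>f p = p\<close>.\<close>

lemma moebius_diff_fixed_point:
  fixes z :: "'a::field"
  assumes "a * d - b * c = 1" "a * p + b = p * (c * p + d)" "c * z + d \<noteq> 0"
  shows "((a * z + b) / (c * z + d) - p) * (c * z + d) * (c * p + d) = z - p"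
proof -
  have "((a * z + b) / (c * z + d) - p) * (c * z + d) = a * z + b - p * (c * z + d)"
    using assms(3) by (simp add: left_diff_distrib)
  moreover have "(a * z + b - p * (c * z + d)) * (c * p + d) = z - p"
    using assms(1,2) by algebra
  ultimately show ?thesis
    by simp
qed

text \<open>
  Along an orbit \<open>\<bar>v n - p\<bar> / \<bar>v n - q\<bar>\<close> is constant; cross-multiplied to allow \<open>v n = q\<close>.
\<close>

lemma moebius_orbit_invariant:
  assumes orbit: "solves_difference_eq (moebius_map a b c d) (\<lambda>n. Some (v n))"
    and det: "a * d - b * c = 1"
    and p: "a * p + b = p * (c * p + d)" and q: "a * q + b = q * (c * q + d)"
    and norm: "cmod (c * p + d) = 1" "cmod (c * q + d) = 1"
  shows "cmod (v n - p) * cmod (v 0 - q) = cmod (v n - q) * cmod (v 0 - p)"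
proof (induction n)
  case 0
  then show ?case by simp
next
  case (Suc n)
  have step: "moebius_map a b c d (Some (v n)) = Some (v (Suc n))"
    using orbit by (simp add: solves_difference_eq_def)
  have nz: "c * v n + d \<noteq> 0" and v: "v (Suc n) = (a * v n + b) / (c * v n + d)"
    using step by (auto simp: moebius_map_def split: if_splits)
  \<comment> \<open>The factor \<open>cmod (c * v n + d)\<close> does not depend on the fixed point
    \<open>x\<close>, so it cancels between \<open>p\<close> and \<open>q\<close>.\<close>
  have contract: "cmod (v n - x) = cmod (v (Suc n) - x) * cmod (c * v n + d)"
    if "a * x + b = x * (c * x + d)" "cmod (c * x + d) = 1" for x
    using arg_cong[OF moebius_diff_fixed_point[OF det that(1) nz], of cmod] that(2)
    by (simp add: v norm_mult)
  show ?case
    using Suc.IH nz by (simp add: contract[OF p norm(1)] contract[OF q norm(2)])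
qed

lemma not_stable_if_rotation:
  assumes det: "a * d - b * c = 1" and "p \<noteq> q"
    and p: "a * p + b = p * (c * p + d)" and q: "a * q + b = q * (c * q + d)"
    and norm: "cmod (c * p + d) = 1" "cmod (c * q + d) = 1"
  shows "\<not> hyers_ulam_stable_on_C (moebius_map a b c d)"
proof
  assume "hyers_ulam_stable_on_C (moebius_map a b c d)"
  then obtain G :: "real \<Rightarrow> real" where lim: "(G \<longlongrightarrow> 0) (at_right 0)"
    and stable: "\<And>\<epsilon> u. \<lbrakk>\<epsilon> > 0;
        \<forall>n. moebius_map a b c d (Some (u n)) \<noteq> None \<and>
          cmod (u (Suc n) - the (moebius_map a b c d (Some (u n)))) \<le> \<epsilon>\<rbrakk> \<Longrightarrow>
        \<exists>v. solves_difference_eq (moebius_map a b c d) (\<lambda>n. Some (v n)) \<and>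
          (\<forall>n. cmod (u n - v n) \<le> G \<epsilon>)"
    unfolding hyers_ulam_stable_on_C_def by blast
  define D where "D = cmod (p - q)"
  have "D > 0"
    using \<open>p \<noteq> q\<close> by (simp add: D_def)
  then have "\<forall>\<^sub>F \<epsilon> in at_right 0. G \<epsilon> < D / 10"
    using lim by (intro order_tendstoD) auto
  then obtain \<delta> where "\<delta> > 0" and G: "\<And>\<epsilon>. 0 < \<epsilon> \<Longrightarrow> \<epsilon> < \<delta> \<Longrightarrow> G \<epsilon> < D / 10"
    unfolding eventually_at_right_field by auto
  obtain N :: nat where N: "2 * D / \<delta> < real N"
    using reals_Archimedean2 by blast
  then have "N > 0"
    using \<open>D > 0\<close> \<open>\<delta> > 0\<close> by (cases "N = 0") (auto simp: field_simps)
  \<comment> \<open>The Lipschitz constant \<open>4 * D\<close> times the radial increment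
    \<open>1 / (2 * N)\<close> of the spiral below.\<close>
  define \<epsilon> where "\<epsilon> = 2 * D / N"
  have \<epsilon>: "\<epsilon> > 0" "\<epsilon> < \<delta>"
    using N \<open>N > 0\<close> \<open>D > 0\<close> \<open>\<delta> > 0\<close> by (auto simp: \<epsilon>_def field_simps)
  define \<rho> where "\<rho> = (c * q + d) / (c * p + d)"
  have \<rho>: "cmod \<rho> = 1"
    using norm by (simp add: \<rho>_def norm_divide)
  \<comment> \<open>The radius grows linearly to 1/2 in \<open>N\<close> steps; \<open>min\<close>
    then freezes it, so the infinite sequence stays in the disc of the Lipschitz bound.\<close>
  define r where "r n = real (min n N) / (2 * N)" for n
  define w where "w n = \<rho> ^ n * of_real (r n)" for n
  define u where "u n = from_fixed_points p q (w n)" for n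
  have r: "0 \<le> r n" "r n \<le> 1/2" for n
    using \<open>N > 0\<close> by (auto simp: r_def field_simps)
  have r_step: "\<bar>r (Suc n) - r n\<bar> \<le> 1 / (2 * N)" for n
  proof -
    have "\<bar>real (min (Suc n) N) - real (min n N)\<bar> \<le> 1"
      by linarith
    then have "\<bar>real (min (Suc n) N) - real (min n N)\<bar> / (2 * N) \<le> 1 / (2 * N)"
      by (rule divide_right_mono) simp
    then show ?thesis
      by (simp add: r_def abs_divide flip: diff_divide_distrib)
  qed
  have norm_w: "cmod (w n) = r n" for n
    using r(1) by (simp add: w_def norm_mult norm_power \<rho>)
  have f_u: "moebius_map a b c d (Some (u n)) = Some (from_fixed_points p q (\<rho> * w n))" for n
    using moebius_map_from_fixed_points[OF p q norm, of "w n"] r(2)[of n]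
    by (simp add: u_def norm_w \<rho>_def)
  have "cmod (u (Suc n) - from_fixed_points p q (\<rho> * w n)) \<le> \<epsilon>" for n
  proof -
    \<comment> \<open>The angle of \<open>w\<close> advances exactly as under \<open>f\<close>, so
      the error is purely radial.\<close>
    have "w (Suc n) - \<rho> * w n = \<rho> ^ Suc n * of_real (r (Suc n) - r n)"
      by (simp add: w_def algebra_simps)
    then have "cmod (w (Suc n) - \<rho> * w n) = \<bar>r (Suc n) - r n\<bar>"
      by (simp only: norm_mult norm_power \<rho> norm_of_real) simp
    then have "cmod (u (Suc n) - from_fixed_points p q (\<rho> * w n)) \<le> 4 * D * \<bar>r (Suc n) - r n\<bar>"
      using from_fixed_points_Lipschitz[of "w (Suc n)" "\<rho> * w n" p q] r(2)
      by (simp add: u_def D_def norm_mult norm_w \<rho>)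
    also have "\<dots> \<le> 4 * D * (1 / (2 * N))"
      using r_step \<open>D > 0\<close> by (intro mult_left_mono) auto
    finally show ?thesis
      by (simp add: \<epsilon>_def)
  qed
  then obtain v where v: "solves_difference_eq (moebius_map a b c d) (\<lambda>n. Some (v n))"
    and close: "\<And>n. cmod (u n - v n) \<le> G \<epsilon>"
    using stable[OF \<epsilon>(1), of u] by (auto simp: f_u)
  have close: "cmod (u n - v n) \<le> D / 10" for n
    using close[of n] G[OF \<epsilon>] by linarith
  have "u 0 = p"
    by (simp add: u_def w_def r_def)
  have v0p: "cmod (v 0 - p) \<le> D / 10"
    using close[of 0] by (simp add: \<open>u 0 = p\<close> norm_minus_commute)
  have v0q: "9/10 * D \<le> cmod (v 0 - q)"
    using close[of 0] norm_triangle_ineq[of "p - v 0" "v 0 - q"] by (simp add: \<open>u 0 = p\<close> D_def)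
  have "cmod (w N) = 1/2"
    using \<open>N > 0\<close> by (simp add: norm_w r_def)
  then have "w N \<noteq> 1"
    by auto
  define A where "A = cmod (u N - q)"
  have "cmod (1 - w N) \<le> 3/2"
    using norm_triangle_ineq4[of 1 "w N"] \<open>cmod (w N) = 1/2\<close> by simp
  then have A: "2/3 * D \<le> A"
    using \<open>w N \<noteq> 1\<close> \<open>D > 0\<close>
    by (simp add: A_def u_def from_fixed_points_diff_snd norm_divide field_simps flip: D_def)
  have "cmod (u N - p) = A / 2"
    using \<open>w N \<noteq> 1\<close>
    by (simp add: A_def u_def from_fixed_points_diff_fst from_fixed_points_diff_snd
        norm_divide norm_mult \<open>cmod (w N) = 1/2\<close>)
  then have vNp: "A / 2 - D / 10 \<le> cmod (v N - p)"
    using close[of N] norm_triangle_ineq[of "u N - v N" "v N - p"] by simp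
  have vNq: "cmod (v N - q) \<le> A + D / 10"
    using close[of N] norm_triangle_ineq[of "v N - u N" "u N - q"]
    by (simp add: A_def norm_minus_commute)
  \<comment> \<open>The distance ratio from \<open>p\<close> and \<open>q\<close> is at most 1/9 at
    \<open>v 0\<close>, but close to 1/2 at \<open>u N\<close>. Equating the cross products for
    \<open>v 0\<close> and \<open>v N\<close> forces \<open>A \<le> 2/7 * D\<close>, against
    \<open>2/3 * D \<le> A\<close>.\<close>
  have "(A / 2 - D / 10) * (9/10 * D) \<le> cmod (v N - p) * cmod (v 0 - q)"
    using vNp v0q \<open>D > 0\<close> by (intro mult_mono) auto
  also have "\<dots> = cmod (v N - q) * cmod (v 0 - p)"
    using moebius_orbit_invariant[OF v det p q norm] .
  also have "\<dots> \<le> (A + D / 10) * (D / 10)"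
    using vNq v0p \<open>D > 0\<close> A by (intro mult_mono) auto
  finally have "D * ((A / 2 - D / 10) * (9/10)) \<le> D * ((A + D / 10) / 10)"
    by (simp add: mult_ac)
  then have "(A / 2 - D / 10) * (9/10) \<le> (A + D / 10) / 10"
    using \<open>D > 0\<close> by (simp only: mult_le_cancel_left_pos)
  then show False
    using A \<open>D > 0\<close> by (simp add: field_simps)
qed

theorem corollary4p4:
  fixes a b c d :: complex
  assumes "c \<noteq> 0" and "a * d - b * c = 1"
    and elliptic: "a + d \<in> \<real>" "-2 < Re (a + d)" "Re (a + d) < 2"
  shows "\<forall>u :: nat \<Rightarrow> riemann_sphere.
           solves_difference_eq (moebius_map a b c d) u \<longrightarrow>
           has_no_hyers_ulam_stability_on_C (moebius_map a b c d) u"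
proof -
  obtain p q where "p \<noteq> q" "a * p + b = p * (c * p + d)" "a * q + b = q * (c * q + d)"
    "cmod (c * p + d) = 1" "cmod (c * q + d) = 1"
    using elliptic_fixed_points[OF assms] .
  then have "\<not> hyers_ulam_stable_on_C (moebius_map a b c d)"
    by (rule not_stable_if_rotation[OF assms(2)])
  then show ?thesis
    by (simp add: has_no_hyers_ulam_stability_on_C_def)
qed

end
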